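(* Let $F$ be any one of the faces $(U_{2,3}^{123},U_{1,1}^{1})$, $(U_{2,3}^{123},U_{1,1}^{4})$, $(U_{2,3}^{123},U_{1,2}^{14})$, $(\mathcal W_2^{14},U_{1,1}^{1})$, $(\mathcal W_2^{34},U_{1,1}^{1})$, $(\mathcal W_2^{14},U_{1,2}^{14})$, $(\mathcal W_2^{24},U_{1,2}^{14})$ of $\Gamma_4$. For real $a,b\ge 0$, the point $\mathbf h=(a,b)\in F$ is entropic if and only if $a=\log v$ for some integer $v\ge1$.
   Context: $N_4=\{1,2,3,4\}$. $\Gamma_4$ is the cone of all polymatroid rank functions on $N_4$. A set function $\mathbf h:2^{N_4}\to\mathbb R$ is called entropic if there is a random vector $(X_1,X_2,X_3,X_4)$, each $X_i$ taking values in a finite set, with $\mathbf h(A)=H(X_A)$ for all $A\subseteq N_4$, where $H$ is Shannon entropy, $X_A=(X_j,j\in A)$ and $\mathbf h(\emptyset)=0$. Logarithms (also in the entropy) are to base $2$. For two (poly)matroids $M_1,M_2$ on $N_4$ with rank functions $\mathbf r_1,\mathbf r_2$, $(M_1,M_2)$ denotes the face $\{a\mathbf r_1+b\mathbf r_2:a,b\ge0\}$ of $\Gamma_4$, and $(a,b)$ denotes the point $a\mathbf r_1+b\mathbf r_2$. For $\alpha\subseteq N_4$ with $|\alpha|=m$, $U^\alpha_{k,m}$ is the matroid on $N_4$ with rank function $\mathbf r(A)=\min\{k,|A\cap\alpha|\}$. For $|\alpha|=2$, $\mathcal W_2^\alpha$ is the matroid on $N_4$ with $\mathbf r(\emptyset)=0$,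 $\mathbf r(A)=1$ if $|A|=1$ or $A=\alpha$, and $\mathbf r(A)=2$ otherwise. Superscripts such as $123$ abbreviate $\{1,2,3\}$. *)

theory Defs
  imports "HOL-Probability.Probability"
begin

abbreviation N4 :: "nat set" where
  "N4 \<equiv> {1, 2, 3, 4}"

text \<open>
  A set function on \<open>N4\<close> is a function of type \<^typ>\<open>nat set \<Rightarrow> real\<close>; only its values on
  subsets of \<open>N4\<close> matter.
\<close>

definition polymatroids4 :: "(nat set \<Rightarrow> real) set" where
  "polymatroids4 = {h. h {} = 0 \<and>
     (\<forall>A B. A \<subseteq> B \<and> B \<subseteq> N4 \<longrightarrow> h A \<le> h B) \<and>
     (\<forall>A B. A \<subseteq> N4 \<and> B \<subseteq> N4 \<longrightarrow> h (A \<union> B) + h (A \<inter> B) \<le> h A + h B)}"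

definition U_rank :: "nat \<Rightarrow> nat set \<Rightarrow> nat set \<Rightarrow> real" where
  "U_rank k \<alpha> A = real (min k (card (A \<inter> \<alpha>)))"

definition W2_rank :: "nat set \<Rightarrow> nat set \<Rightarrow> real" where
  "W2_rank \<alpha> A = (if A = {} then 0 else if card A = 1 \<or> A = \<alpha> then 1 else 2)"

definition face_point ::
  "(nat set \<Rightarrow> real) \<times> (nat set \<Rightarrow> real) \<Rightarrow> real \<Rightarrow> real \<Rightarrow> nat set \<Rightarrow> real" where
  "face_point F a b = (\<lambda>A. a * fst F A + b * snd F A)"

definition face4 :: "(nat set \<Rightarrow> real) \<times> (nat set \<Rightarrow> real) \<Rightarrow> (nat set \<Rightarrow> real) set" where
  "face4 F = {face_point F a b | a b. a \<ge> 0 \<and> b \<ge> 0}"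

definition subvector :: "(nat \<Rightarrow> 'o \<Rightarrow> 'v) \<Rightarrow> nat set \<Rightarrow> 'o \<Rightarrow> nat \<Rightarrow> 'v" where
  "subvector X A = (\<lambda>\<omega>. \<lambda>i\<in>A. X i \<omega>)"

definition shannon_entropy :: "'o measure \<Rightarrow> ('o \<Rightarrow> 'v) \<Rightarrow> real" where
  "shannon_entropy M Y = prob_space.entropy M 2 (count_space (Y ` space M)) Y"

text \<open>
  The sample space and the alphabets are fixed to be subsets of \<^typ>\<open>nat\<close>, since one cannot
  quantify existentially over types.  Lemma \<open>entropicI\<close> below shows that this is no restriction.
\<close>

definition entropic :: "(nat set \<Rightarrow> real) \<Rightarrow> bool" where
  "entropic h \<longleftrightarrow> (\<exists>(M :: nat measure) (X :: nat \<Rightarrow> nat \<Rightarrow> nat).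
     prob_space M \<and> (\<forall>i\<in>N4. simple_function M (X i)) \<and>
     (\<forall>A\<subseteq>N4. h A = shannon_entropy M (subvector X A)))"

lemma shannon_entropy_eq:
  assumes "prob_space M" "simple_function M Y"
  shows "shannon_entropy M Y =
    - (\<Sum>y\<in>Y ` space M. measure M (Y -` {y} \<inter> space M) * log 2 (measure M (Y -` {y} \<inter> space M)))"
proof -
  interpret prob_space M by fact
  interpret information_space M 2 by unfold_locales simp
  have "simple_distributed M Y (\<lambda>y. measure M (Y -` {y} \<inter> space M))"
    using assms(2) by (intro simple_distributedI) (auto intro!: arg_cong[where f="measure M"])
  from entropy_simple_distributed[OF this] show ?thesis
    by (simp add: shannon_entropy_def)
qed

lemma simple_function_subvector:
  assumes "finite A" "\<And>i. i \<in> A \<Longrightarrow> simple_function M (X i)"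
  shows "simple_function M (subvector X A)"
  using assms
proof (induction A rule: finite_induct)
  case empty
  have "subvector X {} = (\<lambda>_. \<lambda>_. undefined)"
    by (simp add: subvector_def restrict_def)
  then show ?case by simp
next
  case (insert j A)
  have "simple_function M (\<lambda>\<omega>. (\<lambda>(g, x). g(j := x)) (subvector X A \<omega>, X j \<omega>))"
    using insert by (intro simple_function_compose1[OF simple_function_Pair]) auto
  moreover have "(\<lambda>\<omega>. (\<lambda>(g, x). g(j := x)) (subvector X A \<omega>, X j \<omega>)) = subvector X (insert j A)"
    using insert by (auto simp: subvector_def restrict_def fun_eq_iff)
  ultimately show ?case by simp
qed

lemma entropicI:
  fixes M :: "'o measure" and X :: "nat \<Rightarrow> 'o \<Rightarrow> 'v"
  assumes M: "prob_space M" and X: "\<And>i. i \<in> N4 \<Longrightarrow> simple_function M (X i)"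
    and h: "\<And>A. A \<subseteq> N4 \<Longrightarrow> h A = shannon_entropy M (subvector X A)"
  shows "entropic h"
proof -
  interpret prob_space M by fact
  define Y where "Y = subvector X N4"
  define J where "J = Y ` space M"
  define e where "e = to_nat_on J"
  define f where "f i = to_nat_on (X i ` space M)" for i
  define X' where "X' i n = f i (inv_into J e n i)" for i n
  define S where "S = e ` J"
  have Y: "simple_function M Y"
    unfolding Y_def using X by (intro simple_function_subvector) auto
  have finJ: "finite J" using Y by (simp add: J_def simple_function_def)
  have inj_e: "inj_on e J"
    unfolding e_def by (intro inj_on_to_nat_on countable_finite finJ)
  define M' where "M' = distr M (count_space S) (\<lambda>\<omega>. e (Y \<omega>))"
  have eY: "simple_function M (\<lambda>\<omega>. e (Y \<omega>))"
    by (rule simple_function_compose1[OF Y])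
  have meas: "(\<lambda>\<omega>. e (Y \<omega>)) \<in> measurable M (count_space S)"
    using eY finJ by (auto simp: S_def J_def measurable_count_space_eq2 simple_function_def)
  have M': "prob_space M'" unfolding M'_def by (rule prob_space_distr[OF meas])
  have spM': "space M' = S" "sets M' = Pow S" by (simp_all add: M'_def)
  have finS: "finite S" using finJ by (simp add: S_def)
  have sf': "simple_function M' Z" for Z :: "nat \<Rightarrow> 'z"
    using finS by (auto simp: simple_function_def spM')
  have "h A = shannon_entropy M' (subvector X' A)" if A: "A \<subseteq> N4" for A
  proof -
    define F where "F g = (\<lambda>i\<in>A. f i (g i))" for g :: "nat \<Rightarrow> 'v"
    let ?T = "subvector X A" and ?T' = "subvector X' A"
    have T: "simple_function M ?T"
      using X A by (intro simple_function_subvector finite_subset[OF A]) auto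
    have eq: "?T' (e (Y \<omega>)) = F (?T \<omega>)" if "\<omega> \<in> space M" for \<omega>
    proof -
      have "inv_into J e (e (Y \<omega>)) = Y \<omega>"
        using that by (intro inv_into_f_f inj_e) (simp add: J_def)
      then show ?thesis using A
        by (auto simp: subvector_def X'_def F_def Y_def fun_eq_iff restrict_def)
    qed
    have inj: "inj_on F (?T ` space M)"
    proof (rule inj_onI)
      fix g g' assume g: "g \<in> ?T ` space M" "g' \<in> ?T ` space M" and eqF: "F g = F g'"
      show "g = g'"
      proof
        fix i
        show "g i = g' i"
        proof (cases "i \<in> A")
          case True
          have "f i (g i) = f i (g' i)"
            using fun_cong[OF eqF, of i] True by (simp add: F_def)
          moreover have "inj_on (f i) (X i ` space M)"
            unfolding f_def using X[of i] A True
            by (intro inj_on_to_nat_on countable_finite) (auto simp: simple_function_def)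
          moreover have "g i \<in> X i ` space M" "g' i \<in> X i ` space M"
            using g True by (auto simp: subvector_def)
          ultimately show ?thesis by (simp add: inj_on_eq_iff)
        next
          case False
          then show ?thesis using g by (auto simp: subvector_def)
        qed
      qed
    qed
    have im: "?T' ` space M' = F ` (?T ` space M)"
      unfolding spM' S_def J_def image_image using eq by (auto intro!: image_cong)
    have pr: "measure M' (?T' -` {F t} \<inter> space M') = measure M (?T -` {t} \<inter> space M)"
      if t: "t \<in> ?T ` space M" for t
    proof -
      have "measure M' (?T' -` {F t} \<inter> space M')
        = measure M ((\<lambda>\<omega>. e (Y \<omega>)) -` (?T' -` {F t} \<inter> S) \<inter> space M)"
        unfolding spM' unfolding M'_def by (intro measure_distr[OF meas]) auto
      also have "(\<lambda>\<omega>. e (Y \<omega>)) -` (?T' -` {F t} \<inter> S) \<inter> space M = ?T -` {t} \<inter> space M"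
      proof (rule set_eqI)
        fix \<omega>
        show "\<omega> \<in> (\<lambda>\<omega>. e (Y \<omega>)) -` (?T' -` {F t} \<inter> S) \<inter> space M \<longleftrightarrow> \<omega> \<in> ?T -` {t} \<inter> space M"
        proof (cases "\<omega> \<in> space M")
          case True
          then have "e (Y \<omega>) \<in> S" by (simp add: S_def J_def)
          moreover have "F (?T \<omega>) = F t \<longleftrightarrow> ?T \<omega> = t"
            using True t by (intro inj_on_eq_iff[OF inj]) auto
          ultimately show ?thesis using eq[OF True] True by simp
        qed simp
      qed
      finally show ?thesis .
    qed
    show ?thesis
      unfolding h[OF A] shannon_entropy_eq[OF M T] shannon_entropy_eq[OF M' sf'] im
      by (subst sum.reindex[OF inj]) (simp add: pr)
  qed
  then show ?thesis
    unfolding entropic_def using M' sf' by blast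
qed

lemma U_rank_polymatroid: "U_rank k \<alpha> \<in> polymatroids4"
proof -
  have "U_rank k \<alpha> A \<le> U_rank k \<alpha> B" if "A \<subseteq> B" "B \<subseteq> N4" for A B
  proof -
    have "finite B" using that(2) by (rule finite_subset) simp
    then have "card (A \<inter> \<alpha>) \<le> card (B \<inter> \<alpha>)"
      using that(1) by (intro card_mono) auto
    then show ?thesis by (simp add: U_rank_def)
  qed
  moreover have "U_rank k \<alpha> (A \<union> B) + U_rank k \<alpha> (A \<inter> B) \<le> U_rank k \<alpha> A + U_rank k \<alpha> B"
    if "A \<subseteq> N4" "B \<subseteq> N4" for A B
  proof -
    have fin: "finite A" "finite B" using finite_subset[OF that(1)] finite_subset[OF that(2)] by simp_all
    have "(A \<union> B) \<inter> \<alpha> = (A \<inter> \<alpha>) \<union> (B \<inter> \<alpha>)" "(A \<inter> B) \<inter> \<alpha> = (A \<inter> \<alpha>) \<inter> (B \<inter> \<alpha>)"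
      by auto
    then have "card (A \<inter> \<alpha>) + card (B \<inter> \<alpha>) = card ((A \<union> B) \<inter> \<alpha>) + card ((A \<inter> B) \<inter> \<alpha>)"
      using fin card_Un_Int[of "A \<inter> \<alpha>" "B \<inter> \<alpha>"] by simp
    moreover have "card ((A \<inter> B) \<inter> \<alpha>) \<le> card (A \<inter> \<alpha>)" "card ((A \<inter> B) \<inter> \<alpha>) \<le> card (B \<inter> \<alpha>)"
      using fin by (auto intro!: card_mono)
    ultimately have "min k (card ((A \<union> B) \<inter> \<alpha>)) + min k (card ((A \<inter> B) \<inter> \<alpha>))
        \<le> min k (card (A \<inter> \<alpha>)) + min k (card (B \<inter> \<alpha>))"
      by linarith
    then show ?thesis unfolding U_rank_def of_nat_add[symmetric] of_nat_le_iff .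
  qed
  ultimately show ?thesis by (simp add: polymatroids4_def) (simp add: U_rank_def)
qed

lemma W2_rank_polymatroid:
  assumes "card \<alpha> = 2"
  shows "W2_rank \<alpha> \<in> polymatroids4"
proof -
  have fin\<alpha>: "finite \<alpha>" using assms card.infinite by fastforce
  have sub: "card C = 1" if "C \<subset> \<alpha>" "C \<noteq> {}" for C
  proof -
    have "card C < 2" using psubset_card_mono[OF fin\<alpha> that(1)] assms by simp
    moreover have "card C \<noteq> 0" using that finite_subset[OF _ fin\<alpha>, of C] by auto
    ultimately show ?thesis by linarith
  qed
  have sub1: "C = B" if "C \<subseteq> B" "C \<noteq> {}" "card B = 1" for B C :: "nat set"
    using that by (auto simp: card_1_singleton_iff)
  have mono: "W2_rank \<alpha> A \<le> W2_rank \<alpha> B" if "A \<subseteq> B" for A B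
    using that sub[of A] sub1[of A B] by (auto simp: W2_rank_def psubset_eq)
  have le2: "W2_rank \<alpha> A \<le> 2" for A by (simp add: W2_rank_def)
  have ge1: "W2_rank \<alpha> A \<ge> 1" if "A \<noteq> {}" for A using that by (simp add: W2_rank_def)
  have "W2_rank \<alpha> (A \<union> B) + W2_rank \<alpha> (A \<inter> B) \<le> W2_rank \<alpha> A + W2_rank \<alpha> B" for A B
  proof (cases "A \<subseteq> B \<or> B \<subseteq> A")
    case True
    then show ?thesis by (auto simp: Un_absorb1 Un_absorb2 Int_absorb1 Int_absorb2)
  next
    case False
    then have ne: "A \<noteq> {}" "B \<noteq> {}" by auto
    show ?thesis
    proof (cases "A \<inter> B = {}")
      case True
      then show ?thesis using ge1[OF ne(1)] ge1[OF ne(2)] le2[of "A \<union> B"]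
        by (simp add: W2_rank_def[of _ "{}"])
    next
      case int: False
      have "card A \<noteq> 1" "card B \<noteq> 1" using int False sub1[of "A \<inter> B" A] sub1[of "A \<inter> B" B] by auto
      moreover have "W2_rank \<alpha> (A \<inter> B) = 1" if "A = \<alpha> \<or> B = \<alpha>"
        using that False int sub[of "A \<inter> B"] by (auto simp: W2_rank_def)
      ultimately show ?thesis using ne False le2[of "A \<union> B"] le2[of "A \<inter> B"]
        by (cases "A = \<alpha> \<or> B = \<alpha>") (auto simp: W2_rank_def[of _ A] W2_rank_def[of _ B])
    qed
  qed
  with mono show ?thesis by (simp add: polymatroids4_def) (simp add: W2_rank_def)
qed

lemma face4_subset_polymatroids4:
  assumes "r1 \<in> polymatroids4" "r2 \<in> polymatroids4"
  shows "face4 (r1, r2) \<subseteq> polymatroids4"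
proof
  fix h assume "h \<in> face4 (r1, r2)"
  then obtain a b where ab: "a \<ge> 0" "b \<ge> 0" and h: "h = (\<lambda>A. a * r1 A + b * r2 A)"
    by (auto simp: face4_def face_point_def)
  have "h (A \<union> B) + h (A \<inter> B) \<le> h A + h B" if "A \<subseteq> N4" "B \<subseteq> N4" for A B
  proof -
    have "a * (r1 (A \<union> B) + r1 (A \<inter> B)) \<le> a * (r1 A + r1 B)"
      "b * (r2 (A \<union> B) + r2 (A \<inter> B)) \<le> b * (r2 A + r2 B)"
      using assms that ab by (auto simp: polymatroids4_def intro!: mult_left_mono)
    then show ?thesis by (simp add: h algebra_simps)
  qed
  moreover have "h A \<le> h B" if "A \<subseteq> B" "B \<subseteq> N4" for A B
    using assms that ab by (auto simp: polymatroids4_def h intro!: add_mono mult_left_mono)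
  moreover have "h {} = 0" using assms by (simp add: polymatroids4_def h)
  ultimately show "h \<in> polymatroids4" by (simp add: polymatroids4_def)
qed

end

(*
  On {1,2,3} every one of the faces consists of the points a * U_{2,3} + c * U_{1,1}^1.  If such a
  point is entropic, any two of X_1, X_2, X_3 are independent, and X_1 together with one of X_2, X_3
  determines the other.  This makes the probabilities of the values of X_2 and X_3 agree on every
  joint outcome; since every pair of values of the independent X_2, X_3 occurs, both are uniform,
  so their common entropy a is the logarithm of the number of values.

  Conversely, take independent p, q uniform on the integers modulo v and t of entropy b.  Each X_i
  is one of p + q, p, q or a constant, together with t when i lies in the support of the second
  matroid; the entropies of all X_A then only depend on how many of p + q, p, q occur in A and on
  whether t does.
*)
theory Submission
  imports Defs "HOL-Real_Asymp.Real_Asymp"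
begin

section \<open>Entropies of functions of one random variable as sums over its support\<close>

text \<open>The probability of the value of \<open>Y\<close>, indexed by outcomes instead of values.
  Laws of different functions thus become functions on the same set \<open>J\<close> and can be
  compared pointwise.\<close>

definition fibre_mass :: "'a set \<Rightarrow> ('a \<Rightarrow> real) \<Rightarrow> ('a \<Rightarrow> 'b) \<Rightarrow> 'a \<Rightarrow> real" where
  "fibre_mass J w Y x = sum w {x' \<in> J. Y x' = Y x}"

text \<open>Summing over atoms of \<open>W\<close> and grouping them by the value of
  \<open>f\<close> recovers the usual sum over values. Null atoms are dropped, so every logarithm
  that remains has a positive argument.\<close>

lemma shannon_entropy_comp:
  fixes f :: "'v \<Rightarrow> 'c"
  assumes M: "prob_space M" and W: "simple_function M W"
  defines "w \<equiv> \<lambda>g. measure M (W -` {g} \<inter> space M)"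
  defines "J \<equiv> {g \<in> W ` space M. w g > 0}"
  shows "shannon_entropy M (\<lambda>\<omega>. f (W \<omega>)) = - (\<Sum>g\<in>J. w g * log 2 (fibre_mass J w f g))"
proof -
  interpret prob_space M by fact
  let ?Y = "\<lambda>\<omega>. f (W \<omega>)"
  have fin: "finite (W ` space M)" using W by (simp add: simple_function_def)
  then have finJ: "finite J" by (simp add: J_def)
  have Y: "simple_function M ?Y" by (rule simple_function_compose1[OF W])
  define p where "p y = measure M (?Y -` {y} \<inter> space M)" for y
  have p: "p y = sum w {g \<in> J. f g = y}" for y
  proof -
    have "?Y -` {y} \<inter> space M = (\<Union>g\<in>{g \<in> W ` space M. f g = y}. W -` {g} \<inter> space M)"
      by auto
    then have "p y = sum w {g \<in> W ` space M. f g = y}"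
      unfolding p_def w_def
      by (simp only:) (rule finite_measure_finite_Union, use fin W in
        \<open>auto simp: disjoint_family_on_def simple_function_def\<close>)
    also have "\<dots> = sum w {g \<in> J. f g = y}"
    proof (rule sum.mono_neutral_right)
      show "\<forall>i\<in>{g \<in> W ` space M. f g = y} - {g \<in> J. f g = y}. w i = 0"
        by (auto simp: J_def w_def) (metis measure_le_0_iff not_le)
    qed (use fin in \<open>auto simp: J_def\<close>)
    finally show ?thesis .
  qed
  have "shannon_entropy M ?Y = - (\<Sum>y\<in>?Y ` space M. p y * log 2 (p y))"
    by (simp add: shannon_entropy_eq[OF M Y] p_def)
  also have "(\<Sum>y\<in>?Y ` space M. p y * log 2 (p y))
      = (\<Sum>y\<in>?Y ` space M. \<Sum>g\<in>{g \<in> J. f g = y}. w g * log 2 (p (f g)))"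
    by (intro sum.cong refl) (subst p, simp add: sum_distrib_right)
  also have "\<dots> = (\<Sum>g\<in>J. w g * log 2 (p (f g)))"
    by (intro sum.group) (use finJ fin in \<open>auto simp: J_def image_image[symmetric, of f W]\<close>)
  also have "\<dots> = (\<Sum>g\<in>J. w g * log 2 (fibre_mass J w f g))"
    by (simp add: p fibre_mass_def)
  finally show ?thesis .
qed

section \<open>Equality cases of entropy inequalities\<close>

locale finite_distribution =
  fixes J :: "'a set" and w :: "'a \<Rightarrow> real"
  assumes finite_J: "finite J"
    and w_pos: "\<And>x. x \<in> J \<Longrightarrow> w x > 0"
    and sum_w: "sum w J = 1"
begin

abbreviation m :: "('a \<Rightarrow> 'b) \<Rightarrow> 'a \<Rightarrow> real" where
  "m \<equiv> fibre_mass J w"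

definition H :: "('a \<Rightarrow> 'b) \<Rightarrow> real" where
  "H Y = - (\<Sum>x\<in>J. w x * log 2 (m Y x))"

lemma fibre_mass_pos: "x \<in> J \<Longrightarrow> m Y x > 0"
  unfolding fibre_mass_def using finite_J by (intro sum_pos) (auto intro: w_pos)

lemma fibre_mass_cong: "Y x = Y x' \<Longrightarrow> m Y x = m Y x'"
  by (simp add: fibre_mass_def)

lemma fibre_mass_mono:
  assumes "\<And>x'. x' \<in> J \<Longrightarrow> Z x' = Z x \<Longrightarrow> Y x' = Y x"
  shows "m Z x \<le> m Y x"
  unfolding fibre_mass_def using finite_J assms w_pos
  by (intro sum_mono2) (auto intro: less_imp_le)

lemma sum_fibre_mass_image: "(\<Sum>y\<in>Y ` J. sum w {x \<in> J. Y x = y}) = 1"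
  using sum.image_gen[OF finite_J, of w Y] sum_w by simp

text \<open>Fibres of \<open>Z\<close> lie inside fibres of \<open>Y\<close>, so
  \<open>H Z - H Y\<close> is a sum of nonnegative terms with positive weights. If it vanishes, so
  does each term: \<open>Y\<close> determines \<open>Z\<close> on the support.\<close>

lemma fibre_mass_eq_if_refinement_entropy_eq:
  assumes ref: "\<And>x x'. x \<in> J \<Longrightarrow> x' \<in> J \<Longrightarrow> Z x = Z x' \<Longrightarrow> Y x = Y x'"
    and H: "H Y = H Z" and x: "x \<in> J"
  shows "m Y x = m Z x"
proof -
  have le: "m Z x \<le> m Y x" if "x \<in> J" for x
    using that by (intro fibre_mass_mono) (rule ref)
  have "(\<Sum>x\<in>J. w x * (log 2 (m Y x) - log 2 (m Z x))) = 0"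
    using H by (simp add: H_def right_diff_distrib sum_subtractf)
  moreover have "0 \<le> w x * (log 2 (m Y x) - log 2 (m Z x))" if "x \<in> J" for x
    using le[OF that] fibre_mass_pos[OF that, of Y] fibre_mass_pos[OF that, of Z] w_pos[OF that]
    by (intro mult_nonneg_nonneg) (auto intro: less_imp_le)
  ultimately have "w x * (log 2 (m Y x) - log 2 (m Z x)) = 0"
    using sum_nonneg_0[OF finite_J, of "\<lambda>x. w x * (log 2 (m Y x) - log 2 (m Z x))", OF _ _ x]
    by blast
  then have "log 2 (m Y x) = log 2 (m Z x)" using w_pos[OF x] by simp
  then show ?thesis
    using inj_onD[OF log_inj[of 2], of "m Y x" "m Z x"]
      fibre_mass_pos[OF x, of Y] fibre_mass_pos[OF x, of Z] by simp
qed

text \<open>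
  The equality case of Gibbs' inequality; it yields more than the product formula on the support,
  namely that every pair of values is attained.
\<close>
lemma independent_if_entropy_additive:
  assumes ker: "\<And>x x'. x \<in> J \<Longrightarrow> x' \<in> J \<Longrightarrow> Z x = Z x' \<longleftrightarrow> X x = X x' \<and> Y x = Y x'"
    and H: "H Z = H X + H Y"
  shows fibre_mass_mult_if_entropy_additive: "\<And>x. x \<in> J \<Longrightarrow> m Z x = m X x * m Y x"
    and joint_value_if_entropy_additive:
      "\<And>x y. x \<in> J \<Longrightarrow> y \<in> J \<Longrightarrow> \<exists>z\<in>J. X z = X x \<and> Y z = Y y"
proof -
  \<comment> \<open>The density of the product of the marginals relative to the joint law. The goal
    is that it is identically 1.\<close>
  define r where "r x = m X x * m Y x / m Z x" for x
  define pX where "pX u = sum w {x \<in> J. X x = u}" for u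
  define pY where "pY u = sum w {x \<in> J. Y x = u}" for u
  let ?S = "(\<lambda>x. (X x, Y x)) ` J"
  have r_pos: "r x > 0" if "x \<in> J" for x
    using that by (simp add: r_def fibre_mass_pos)
  have pos: "pX (X x) > 0" "pY (Y x) > 0" if "x \<in> J" for x
    using fibre_mass_pos[OF that, of X] fibre_mass_pos[OF that, of Y]
    by (simp_all add: pX_def pY_def fibre_mass_def)
  have all: "(\<Sum>(u, u')\<in>X ` J \<times> Y ` J. pX u * pY u') = 1"
    using sum_fibre_mass_image[of X] sum_fibre_mass_image[of Y]
    by (simp add: sum.cartesian_product[symmetric] sum_product[symmetric] pX_def pY_def)
  \<comment> \<open>The mean of \<open>r\<close> is the product mass of the attained pairs
    \<open>?S\<close>, hence at most the total product mass 1.\<close>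
  have "(\<Sum>x\<in>J. w x * r x) = (\<Sum>s\<in>?S. \<Sum>x\<in>{x \<in> J. (X x, Y x) = s}. w x * r x)"
    by (rule sum.image_gen[OF finite_J])
  also have "\<dots> = (\<Sum>(u, u')\<in>?S. pX u * pY u')"
  proof (rule sum.cong[OF refl])
    fix s assume "s \<in> ?S"
    then obtain z where z: "z \<in> J" and s: "s = (X z, Y z)" by auto
    have "(\<Sum>x\<in>{x \<in> J. (X x, Y x) = s}. w x * r x) = (\<Sum>x\<in>{x \<in> J. (X x, Y x) = s}. w x * r z)"
    proof (intro sum.cong refl)
      fix x assume "x \<in> {x \<in> J. (X x, Y x) = s}"
      then have "m X x = m X z" "m Y x = m Y z" "m Z x = m Z z"
        using z s ker by (auto intro!: fibre_mass_cong)
      then show "w x * r x = w x * r z" by (simp add: r_def)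
    qed
    also have "\<dots> = m Z z * r z"
    proof -
      have "{x \<in> J. (X x, Y x) = s} = {x \<in> J. Z x = Z z}" using z s ker by auto
      then show ?thesis by (simp add: fibre_mass_def sum_distrib_right)
    qed
    also have "\<dots> = m X z * m Y z"
      using fibre_mass_pos[OF z, of Z] by (simp add: r_def)
    finally show "(\<Sum>x\<in>{x \<in> J. (X x, Y x) = s}. w x * r x) = (case s of (u, u') \<Rightarrow> pX u * pY u')"
      by (simp add: s fibre_mass_def pX_def pY_def)
  qed
  finally have sum_r: "(\<Sum>x\<in>J. w x * r x) = (\<Sum>(u, u')\<in>?S. pX u * pY u')" .
  also have "\<dots> \<le> (\<Sum>(u, u')\<in>X ` J \<times> Y ` J. pX u * pY u')"
    by (intro sum_mono2) (use finite_J pos in \<open>auto simp: less_imp_le\<close>)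
  finally have le: "(\<Sum>x\<in>J. w x * r x) \<le> 1" using all by simp
  \<comment> \<open>Additivity of the entropy says exactly that \<open>log 2 (r x)\<close> has mean
    zero. Then the nonnegative quantity \<open>r x - 1 - ln (r x)\<close> has mean at most zero,
    which forces equality throughout.\<close>
  have "(\<Sum>x\<in>J. w x * log 2 (r x)) = (\<Sum>x\<in>J. w x * (log 2 (m X x) + log 2 (m Y x) - log 2 (m Z x)))"
    by (intro sum.cong refl) (simp add: r_def log_divide log_mult fibre_mass_pos less_imp_neq[symmetric])
  also have "\<dots> = 0"
    using H by (simp add: H_def distrib_left right_diff_distrib sum.distrib sum_subtractf)
  finally have "(\<Sum>x\<in>J. w x * ln (r x)) = 0"
    by (simp add: log_def sum_divide_distrib[symmetric])
  then have gap: "(\<Sum>x\<in>J. w x * (r x - 1 - ln (r x))) = (\<Sum>x\<in>J. w x * r x) - 1"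
    by (simp add: right_diff_distrib sum_subtractf sum_w)
  have nonneg: "0 \<le> w x * (r x - 1 - ln (r x))" if "x \<in> J" for x
    using ln_le_minus_one[OF r_pos[OF that]] w_pos[OF that] by simp
  then have "0 \<le> (\<Sum>x\<in>J. w x * (r x - 1 - ln (r x)))" by (rule sum_nonneg)
  then have one: "(\<Sum>x\<in>J. w x * r x) = 1" using gap le by simp
  then have zero: "(\<Sum>x\<in>J. w x * (r x - 1 - ln (r x))) = 0" using gap by simp
  show "m Z x = m X x * m Y x" if x: "x \<in> J" for x
  proof -
    have "w x * (r x - 1 - ln (r x)) = 0"
      using sum_nonneg_0[of J "\<lambda>x. w x * (r x - 1 - ln (r x))", OF finite_J nonneg zero x] .
    then have "ln (r x) = r x - 1" using w_pos[OF x] by simp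
    then have "r x = 1" by (rule ln_eq_minus_one[OF r_pos[OF x]])
    then show ?thesis using fibre_mass_pos[OF x, of Z] by (simp add: r_def)
  qed
  show "\<exists>z\<in>J. X z = X x \<and> Y z = Y y" if "x \<in> J" "y \<in> J" for x y
  proof (rule ccontr)
    \<comment> \<open>A pair that is not attained still has positive product mass, so
      \<open>?S\<close> would have product mass below 1.\<close>
    assume "\<not> ?thesis"
    then have "(X x, Y y) \<in> X ` J \<times> Y ` J - ?S" using that by auto
    then have "(\<Sum>(u, u')\<in>?S. pX u * pY u') < (\<Sum>(u, u')\<in>X ` J \<times> Y ` J. pX u * pY u')"
      by (intro sum_strict_mono2[of _ _ "(X x, Y y)"])
         (use finite_J pos that in \<open>auto simp: less_imp_le\<close>)
    then show False using all one sum_r by simp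
  qed
qed

lemma entropy_eq_log_card_if_uniform:
  assumes "\<And>x x'. x \<in> J \<Longrightarrow> x' \<in> J \<Longrightarrow> m Y x = m Y x'"
  shows "H Y = log 2 (card (Y ` J))" "card (Y ` J) \<ge> 1"
proof -
  have "J \<noteq> {}" using sum_w by auto
  then obtain z where z: "z \<in> J" by auto
  let ?n = "card (Y ` J)"
  show n: "?n \<ge> 1" using finite_J z card_gt_0_iff[of "Y ` J"] by (auto simp: Suc_le_eq)
  have mz: "m Y x = m Y z" if "x \<in> J" for x using that z by (rule assms)
  then have "1 = (\<Sum>y\<in>Y ` J. m Y z)"
    unfolding sum_fibre_mass_image[of Y, symmetric]
    by (intro sum.cong refl) (auto simp: fibre_mass_def)
  then have "1 = ?n * m Y z" by simp
  then have "m Y z = inverse ?n" using n by (simp add: field_simps)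
  then have "H Y = - (\<Sum>x\<in>J. w x * log 2 (inverse ?n))"
    by (simp add: H_def mz)
  also have "\<dots> = - log 2 (inverse ?n)"
    by (simp add: sum_distrib_right[symmetric] sum_w)
  also have "\<dots> = log 2 ?n" using n by (simp add: log_inverse)
  finally show "H Y = log 2 ?n" .
qed

end

section \<open>Necessity: the coefficient of the first matroid is a logarithm\<close>

text \<open>
  With \<open>p\<close> denoting the probability of the value taken, the hypotheses force
  \<open>p\<^sub>1 p\<^sub>2 = p\<^sub>1\<^sub>2 = p\<^sub>1\<^sub>2\<^sub>3 = p\<^sub>1\<^sub>3 = p\<^sub>1 p\<^sub>3\<close>
  everywhere, hence \<open>p\<^sub>2 = p\<^sub>3\<close>; as every pair of values of \<open>X\<^sub>2, X\<^sub>3\<close> occurs, both are constant.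
\<close>
lemma entropic_imp_log:
  assumes "entropic h" and "h {1} = a + c" "h {2} = a" "h {3} = a"
    and "h {1,2} = 2 * a + c" "h {1,3} = 2 * a + c" "h {2,3} = 2 * a" "h {1,2,3} = 2 * a + c"
  shows "\<exists>v::nat. v \<ge> 1 \<and> a = log 2 (real v)"
proof -
  obtain M :: "nat measure" and X :: "nat \<Rightarrow> nat \<Rightarrow> nat" where M: "prob_space M"
    and X': "\<forall>i\<in>N4. simple_function M (X i)"
    and h': "\<forall>A\<subseteq>N4. h A = shannon_entropy M (subvector X A)"
    using assms(1) unfolding entropic_def by (elim exE conjE)
  note X = bspec[OF X'] and h = h'[rule_format]
  interpret prob_space M by fact
  define W where "W = subvector X N4"
  define w where "w g = measure M (W -` {g} \<inter> space M)" for g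
  define J where "J = {g \<in> W ` space M. w g > 0}"
  have W: "simple_function M W"
    unfolding W_def using X by (intro simple_function_subvector) auto
  have fin: "finite (W ` space M)" using W by (simp add: simple_function_def)
  have "sum w J = sum w (W ` space M)"
    by (rule sum.mono_neutral_left)
       (use fin in \<open>auto simp: J_def w_def, metis measure_le_0_iff not_le\<close>)
  also have "\<dots> = measure M (\<Union>g\<in>W ` space M. W -` {g} \<inter> space M)"
    unfolding w_def by (rule finite_measure_finite_Union[symmetric])
      (use fin W in \<open>auto simp: disjoint_family_on_def simple_function_def\<close>)
  also have "(\<Union>g\<in>W ` space M. W -` {g} \<inter> space M) = space M" by auto
  finally have "sum w J = 1" by (simp add: prob_space)
  then interpret fd: finite_distribution J w
    by unfold_locales (use fin in \<open>auto simp: J_def\<close>)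
  \<comment> \<open>Every \<open>X_A\<close> is the restriction of the full vector \<open>W\<close>,
    so all entropies can be computed on the single support \<open>J\<close>.\<close>
  define R where "R A g = (\<lambda>i\<in>A. g i)" for A and g :: "nat \<Rightarrow> nat"
  have hA: "h A = fd.H (R A)" if "A \<subseteq> N4" for A
  proof -
    have "subvector X A = (\<lambda>\<omega>. R A (W \<omega>))"
      using that by (auto simp: subvector_def W_def R_def fun_eq_iff restrict_def)
    then show ?thesis
      using shannon_entropy_comp[OF M W, of "R A", folded w_def, folded J_def] h[OF that]
      by (simp add: fd.H_def)
  qed
  have ker: "R A x = R A x' \<longleftrightarrow> (\<forall>i\<in>A. x i = x' i)" for A x x'
    by (auto simp: R_def fun_eq_iff restrict_def)
  have "fd.H (R {1}) = a + c" and H2: "fd.H (R {2}) = a" and "fd.H (R {3}) = a"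
    and "fd.H (R {1,2}) = 2 * a + c" and "fd.H (R {1,3}) = 2 * a + c"
    and "fd.H (R {2,3}) = 2 * a" and "fd.H (R {1,2,3}) = 2 * a + c"
    using assms(2-) by (simp_all add: hA)
  note hyps = this
  have p12: "fd.m (R {1,2}) x = fd.m (R {1}) x * fd.m (R {2}) x" if "x \<in> J" for x
    by (rule fd.fibre_mass_mult_if_entropy_additive[OF _ _ that]) (use hyps in \<open>auto simp: ker\<close>)
  have p13: "fd.m (R {1,3}) x = fd.m (R {1}) x * fd.m (R {3}) x" if "x \<in> J" for x
    by (rule fd.fibre_mass_mult_if_entropy_additive[OF _ _ that]) (use hyps in \<open>auto simp: ker\<close>)
  have pq: "\<exists>z\<in>J. R {2} z = R {2} x \<and> R {3} z = R {3} y" if "x \<in> J" "y \<in> J" for x y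
    by (rule fd.joint_value_if_entropy_additive[where Z = "R {2,3}", OF _ _ that])
       (use hyps in \<open>auto simp: ker\<close>)
  have p123: "fd.m (R {1,2}) x = fd.m (R {1,2,3}) x" "fd.m (R {1,3}) x = fd.m (R {1,2,3}) x"
    if "x \<in> J" for x
    by (rule fd.fibre_mass_eq_if_refinement_entropy_eq[OF _ _ that]; use hyps in \<open>auto simp: ker\<close>)+
  have p23: "fd.m (R {2}) x = fd.m (R {3}) x" if "x \<in> J" for x
  proof -
    have "fd.m (R {1}) x * fd.m (R {2}) x = fd.m (R {1}) x * fd.m (R {3}) x"
      using p12[OF that] p13[OF that] p123[OF that] by metis
    then show ?thesis using fd.fibre_mass_pos[OF that, of "R {1}"] by simp
  qed
  have "fd.m (R {2}) x = fd.m (R {2}) y" if xy: "x \<in> J" "y \<in> J" for x y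
  proof -
    \<comment> \<open>The outcome \<open>z\<close> links \<open>x\<close> and \<open>y\<close>: the
      mass of \<open>X_2\<close> at \<open>x\<close> is that at \<open>z\<close>, which is the mass
      of \<open>X_3\<close> at \<open>z\<close> and so at \<open>y\<close>, which is the mass of
      \<open>X_2\<close> at \<open>y\<close>.\<close>
    obtain z where z: "z \<in> J" "R {2} z = R {2} x" "R {3} z = R {3} y" using pq[OF xy] by blast
    then have "fd.m (R {2}) z = fd.m (R {2}) x" "fd.m (R {3}) z = fd.m (R {3}) y"
      by (auto intro!: fd.fibre_mass_cong)
    then show ?thesis using p23[OF z(1)] p23[OF xy(2)] by simp
  qed
  from fd.entropy_eq_log_card_if_uniform[of "R {2}", OF this] H2 show ?thesis by auto
qed

section \<open>Sufficiency: construction of the random vectors\<close>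

text \<open>For positive \<open>b\<close>, take \<open>k\<close> atoms of mass \<open>s\<close> and
  one of mass \<open>1 - k * s\<close>. The entropy is continuous in \<open>s\<close>, tends to 0
  with \<open>s\<close> and reaches \<open>log 2 (k + 1)\<close> at the uniform distribution, so the
  intermediate value theorem applies once \<open>k\<close> is large.\<close>

lemma ex_distribution_with_entropy:
  assumes "b \<ge> 0"
  shows "\<exists>(n::nat) q. (\<forall>i<n. q i > 0) \<and> (\<Sum>i<n. q i) = 1 \<and> - (\<Sum>i<n. q i * log 2 (q i)) = b"
proof (cases "b = 0")
  case True
  then show ?thesis by (intro exI[of _ 1] exI[of _ "\<lambda>_. 1"]) simp
next
  case False
  then have b: "b > 0" using assms by simp
  obtain k :: nat where k: "2 powr b < real k" using reals_Archimedean2 by blast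
  have k_pos: "real k > 0" using k by (smt (verit) powr_gt_zero)
  then have "b < log 2 (real k)" using k by (simp add: less_log_iff)
  then have up: "b \<le> log 2 (real k + 1)"
    using k_pos log_le_cancel_iff[of 2 "real k" "real k + 1"] by linarith
  define f where "f s = - ((1 - real k * s) * log 2 (1 - real k * s) + real k * (s * log 2 s))" for s
  define e where "e = 1 / (real k + 1)"
  have e: "e > 0" "1 - real k * e = e" using k_pos by (simp_all add: e_def field_simps)
  have fe: "f e = log 2 (real k + 1)"
  proof -
    have "f e = - ((1 + real k) * e * log 2 e)" unfolding f_def e(2) by (simp add: algebra_simps)
    also have "(1 + real k) * e = 1" using k_pos by (simp add: e_def field_simps)
    also have "log 2 e = - log 2 (real k + 1)" using k_pos by (simp add: e_def log_divide)
    finally show ?thesis by simp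
  qed
  \<comment> \<open>The right-hand limit replaces the value at 0. The interval then starts at a
    positive \<open>s0\<close>, where all masses are positive and the logarithms continuous.\<close>
  have "(f \<longlongrightarrow> 0) (at_right 0)" unfolding f_def using k_pos by real_asymp
  then have "eventually (\<lambda>s. f s < b \<and> s < e \<and> s > 0) (at_right 0)"
    using b e(1) by (intro eventually_conj order_tendstoD(2)[where y = 0] eventually_at_right_less
      eventually_at_rightI[of 0 e]) auto
  then obtain s0 where s0: "f s0 < b" "s0 < e" "s0 > 0"
    using eventually_happens[of _ "at_right (0::real)"] by auto
  have ke: "real k * s < 1" if "s \<le> e" for s
  proof -
    have "real k * s \<le> real k * e" using that by (intro mult_left_mono) auto
    then show ?thesis using e by linarith
  qed
  have pos: "\<forall>s\<in>{s0..e}. 1 - real k * s \<noteq> 0" "\<forall>s\<in>{s0..e}. s \<noteq> 0"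
    using ke s0 by fastforce+
  have "continuous_on {s0..e} f"
    unfolding f_def by (intro continuous_intros pos) auto
  then obtain s where s: "s \<ge> s0" "s \<le> e" "f s = b"
    using IVT'[of f s0 b e] s0 up fe by auto
  define q where "q i = (if i = 0 then 1 - real k * s else s)" for i :: nat
  show ?thesis
  proof (intro exI[of _ "Suc k"] exI[of _ q] conjI allI impI)
    show "q i > 0" for i using s s0 ke[OF s(2)] by (simp add: q_def)
    show "(\<Sum>i<Suc k. q i) = 1" unfolding sum.lessThan_Suc_shift by (simp add: q_def)
    show "- (\<Sum>i<Suc k. q i * log 2 (q i)) = b"
      unfolding sum.lessThan_Suc_shift s(3)[symmetric] by (simp add: q_def f_def)
  qed
qed

text \<open>
  The indices 1, 2, 3 stand for the elements of \<open>U\<^sub>2\<^sub>,\<^sub>3\<close>, the index 0 for a loop.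
\<close>
definition lin :: "nat \<Rightarrow> nat \<Rightarrow> nat \<times> nat \<Rightarrow> nat" where
  "lin v k z = (if k = 1 then (fst z + snd z) mod v else if k = 2 then fst z
     else if k = 3 then snd z else 0)"

text \<open>Any two of \<open>p + q\<close>, \<open>p\<close>, \<open>q\<close> modulo
  \<open>v\<close> determine the third by cancellation, each single one leaves \<open>v\<close>
  choices, and the loop 0 imposes no condition. This represents \<open>U_{2,3}\<close> over the
  integers modulo \<open>v\<close>.\<close>

lemma card_lin_fibre:
  assumes K: "K \<subseteq> {0..3}" and z: "z \<in> {..<v} \<times> {..<v}"
  shows "real (card {z' \<in> {..<v} \<times> {..<v}. \<forall>k\<in>K. lin v k z' = lin v k z})
    = real v ^ 2 / real v ^ min 2 (card (K - {0}))"
proof -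
  obtain p q where pq: "z = (p, q)" "p < v" "q < v" using z by auto
  then have v: "v > 0" by simp
  let ?F = "\<lambda>K. {z' \<in> {..<v} \<times> {..<v}. \<forall>k\<in>K. lin v k z' = lin v k z}"
  have cancel: "x = x'" if "(x + y) mod v = (x' + y) mod v" "x < v" "x' < v" for x x' y
    using that
  proof (induction x x' rule: linorder_wlog)
    case (le x x')
    then have "v dvd (x' + y) - (x + y)" by (subst mod_eq_dvd_iff_nat[symmetric]) auto
    then show ?case using le by (auto dest: dvd_imp_le)
  qed (simp add: eq_commute)
  have "lin v 0 x = lin v 0 y" for x y by (simp add: lin_def)
  then have "(\<forall>k\<in>K. lin v k z' = lin v k z) \<longleftrightarrow> (\<forall>k\<in>K - {0}. lin v k z' = lin v k z)" for z'
    by blast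
  then have F0: "?F K = ?F (K - {0})" by simp
  have one: "real (card (?F {k})) = real v" if "k \<in> {1,2,3}" for k
  proof -
    have "card (?F {2}) = v"
    proof -
      have "?F {2} = {p} \<times> {..<v}" using pq by (auto simp: lin_def)
      then show ?thesis by simp
    qed
    moreover have "card (?F {3}) = v"
    proof -
      have "?F {3} = {..<v} \<times> {q}" using pq by (auto simp: lin_def)
      then show ?thesis by simp
    qed
    moreover have "card (?F {1}) = v"
    proof -
      have "bij_betw fst (?F {1}) {..<v}"
      proof (rule bij_betwI')
        fix x y assume "x \<in> ?F {1}" "y \<in> ?F {1}"
        then show "fst x = fst y \<longleftrightarrow> x = y"
          by (auto simp: lin_def prod_eq_iff intro!: cancel[of "snd x" "fst x" "snd y"] simp: add.commute)
      next
        fix x assume x: "x \<in> {..<v}"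
        \<comment> \<open>Adding \<open>v\<close> before subtracting \<open>x < v\<close> keeps the
          subtraction of naturals from truncating.\<close>
        have "(x + (p + q + v - x) mod v) mod v = (p + q) mod v"
          using x by (simp add: mod_add_right_eq)
        then show "\<exists>y\<in>?F {1}. x = fst y"
          using x v pq by (intro bexI[of _ "(x, (p + q + v - x) mod v)"]) (auto simp: lin_def)
      qed (auto)
      then show ?thesis using bij_betw_same_card by fastforce
    qed
    ultimately show ?thesis using that by auto
  qed
  have two: "?F L = {z}" if L: "{1,2} \<subseteq> L \<or> {1,3} \<subseteq> L \<or> {2,3} \<subseteq> L" for L
  proof -
    have "z' = z" if z': "z' \<in> ?F L" for z'
    proof -
      obtain p' q' where pq': "z' = (p', q')" "p' < v" "q' < v" using z' by (cases z') auto
      have "1 \<in> L \<Longrightarrow> (p' + q') mod v = (p + q) mod v" "2 \<in> L \<Longrightarrow> p' = p" "3 \<in> L \<Longrightarrow> q' = q"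
        using z' by (auto simp: lin_def pq pq')
      then show ?thesis
        using L pq pq' cancel[of p' q p] cancel[of q' p q] by (auto simp: add.commute)
    qed
    then show ?thesis using z by auto
  qed
  define L where "L = K - {0}"
  have L: "L \<subseteq> {1,2,3}"
  proof
    fix x assume "x \<in> L"
    then have "x \<le> 3" "x \<noteq> 0" using K by (auto simp: L_def)
    then show "x \<in> {1,2,3}" by auto
  qed
  then have finL: "finite L" by (rule finite_subset) simp
  have "card L = 0 \<or> card L = 1 \<or> card L \<ge> 2" by linarith
  then have "real (card (?F L)) = real v ^ 2 / real v ^ min 2 (card L)"
  proof (elim disjE)
    assume "card L = 0"
    then show ?thesis using finL by (simp add: power2_eq_square card_cartesian_product)
  next
    assume c: "card L = 1"
    then obtain k where "L = {k}" by (auto simp: card_1_singleton_iff)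
    then show ?thesis using one[of k] L c v by (simp add: power2_eq_square)
  next
    assume c: "card L \<ge> 2"
    then obtain j k where "j \<in> L" "k \<in> L" "j \<noteq> k"
      by (metis card_2_iff' obtain_subset_with_card_n subset_iff)
    then have "{1,2} \<subseteq> L \<or> {1,3} \<subseteq> L \<or> {2,3} \<subseteq> L" using L by blast
    then have "?F L = {z}" by (rule two)
    then show ?thesis using c v by (simp add: min_absorb1)
  qed
  then show ?thesis unfolding F0 L_def .
qed

text \<open>The map \<open>L\<close> sends each element to one of \<open>p + q\<close>,
  \<open>p\<close>, \<open>q\<close> or the loop; elements with the same image are parallel, which
  is why the image set is counted. The set \<open>B\<close> holds the elements that also carry the
  independent \<open>t\<close> of entropy \<open>b\<close>.\<close>

lemma entropic_lin:
  fixes L :: "nat \<Rightarrow> nat"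
  assumes v: "(v::nat) \<ge> 1" and b: "b \<ge> 0" and L: "\<And>i. i \<in> N4 \<Longrightarrow> L i \<le> 3"
    and h: "\<And>A. A \<subseteq> N4 \<Longrightarrow> h A = log 2 v * real (min 2 (card (L ` A - {0}))) + (if A \<inter> B = {} then 0 else b)"
  shows "entropic h"
proof -
  obtain n :: nat and q where q: "\<And>i. i < n \<Longrightarrow> q i > 0" "(\<Sum>i<n. q i) = 1"
    "- (\<Sum>i<n. q i * log 2 (q i)) = b"
    using ex_distribution_with_entropy[OF b] by blast
  define V where "V = {..<v} \<times> {..<v}"
  define \<Omega> where "\<Omega> = V \<times> {..<n}"
  define w where "w = (\<lambda>(z :: nat \<times> nat, t). q t / real v ^ 2)"
  define M where "M = point_measure \<Omega> (\<lambda>x. ennreal (w x))"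
  define X where "X i = (\<lambda>(z, t :: nat). (lin v (L i) z, if i \<in> B then t else 0))" for i
  have finV: "finite V" "card V = v ^ 2" by (simp_all add: V_def card_cartesian_product power2_eq_square)
  have fin: "finite \<Omega>" using finV by (simp add: \<Omega>_def)
  have w_pos: "w x > 0" if "x \<in> \<Omega>" for x
    using that q v by (auto simp: \<Omega>_def w_def)
  \<comment> \<open>Sums out the uniform component, leaving an expectation over
    \<open>t\<close>.\<close>
  have marg: "(\<Sum>x\<in>\<Omega>. w x * f (snd x)) = (\<Sum>t<n. q t * f t)" for f
  proof -
    have "(\<Sum>x\<in>\<Omega>. w x * f (snd x)) = (\<Sum>z\<in>V. \<Sum>t<n. q t * f t / real v ^ 2)"
      unfolding \<Omega>_def sum.cartesian_product by (intro sum.cong) (auto simp: w_def)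
    then show ?thesis using v by (simp add: finV sum_divide_distrib[symmetric])
  qed
  have sum_w: "sum w \<Omega> = 1" using marg[of "\<lambda>_. 1"] q(2) by simp
  have spM: "space M = \<Omega>" by (simp add: M_def space_point_measure)
  have sf: "simple_function M Z" for Z :: "(nat \<times> nat) \<times> nat \<Rightarrow> 'z"
    using fin by (auto simp: simple_function_def spM) (simp add: M_def sets_point_measure)
  have prM: "prob_space M"
  proof
    have "emeasure M \<Omega> = ennreal (sum w \<Omega>)"
      unfolding M_def using fin w_pos
      by (subst emeasure_point_measure_finite) (auto intro!: sum_ennreal less_imp_le)
    then show "emeasure M (space M) = 1" by (simp add: spM sum_w)
  qed
  interpret fd: finite_distribution \<Omega> w
    by unfold_locales (use fin w_pos sum_w in auto)
  have wM: "measure M ((\<lambda>x. x) -` {x} \<inter> space M) = w x" if "x \<in> \<Omega>" for x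
  proof -
    have "emeasure M {x} = ennreal (w x)"
      unfolding M_def using fin that by (subst emeasure_point_measure_finite) auto
    moreover have "(\<lambda>x. x) -` {x} \<inter> space M = {x}" using that by (auto simp: spM)
    ultimately show ?thesis using w_pos[OF that] by (simp add: measure_def)
  qed
  have "h A = shannon_entropy M (subvector X A)" if A: "A \<subseteq> N4" for A
  proof -
    let ?Y = "subvector X A"
    let ?r = "min 2 (card (L ` A - {0}))"
    \<comment> \<open>\<open>shannon_entropy_comp\<close> is applied with the identity as
      \<open>W\<close>; its support is all of \<open>\<Omega>\<close>.\<close>
    let ?J = "{g \<in> (\<lambda>x. x) ` space M. measure M ((\<lambda>x. x) -` {g} \<inter> space M) > 0}"
    have J: "?J = \<Omega>" using wM w_pos by (auto simp: spM)
    have mass: "fibre_mass ?J (\<lambda>g. measure M ((\<lambda>x. x) -` {g} \<inter> space M)) ?Y x = fd.m ?Y x" for x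
      unfolding fibre_mass_def J using wM by (intro sum.cong) auto
    have ent: "shannon_entropy M ?Y = fd.H ?Y"
      using shannon_entropy_comp[OF prM sf, of "?Y" "\<lambda>x. x"]
      unfolding mass unfolding J fd.H_def using wM by simp
    have ker: "?Y (z', t') = ?Y (z, t) \<longleftrightarrow>
        (\<forall>k\<in>L ` A. lin v k z' = lin v k z) \<and> (A \<inter> B \<noteq> {} \<longrightarrow> t' = t)" for z' t' z t
    proof -
      have "?Y (z', t') = ?Y (z, t) \<longleftrightarrow> (\<forall>i\<in>A. X i (z', t') = X i (z, t))"
        by (auto simp: subvector_def fun_eq_iff restrict_def)
      then show ?thesis by (auto simp: X_def)
    qed
    have "fd.m ?Y x = (if A \<inter> B = {} then 1 else q (snd x)) / real v ^ ?r" if x: "x \<in> \<Omega>" for x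
    proof -
      obtain z t where zt: "x = (z, t)" "z \<in> V" "t < n" using x by (auto simp: \<Omega>_def)
      let ?G = "{z' \<in> V. \<forall>k\<in>L ` A. lin v k z' = lin v k z}"
      let ?T = "if A \<inter> B = {} then {..<n} else {t}"
      have LA: "L ` A \<subseteq> {0..3}" using L A by auto
      \<comment> \<open>The fibre is a product: the linear conditions restrict \<open>z\<close>, and
        \<open>t\<close> is either free or fixed according to whether \<open>A\<close> meets
        \<open>B\<close>.\<close>
      have "{x' \<in> \<Omega>. ?Y x' = ?Y x} = ?G \<times> ?T"
        using zt by (auto simp: \<Omega>_def ker)
      then have "fd.m ?Y x = (\<Sum>z\<in>?G. \<Sum>t\<in>?T. q t / real v ^ 2)"
        unfolding fibre_mass_def sum.cartesian_product by (intro sum.cong) (auto simp: w_def)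
      also have "\<dots> = real (card ?G) * ((\<Sum>t\<in>?T. q t) / real v ^ 2)"
        by (simp add: sum_divide_distrib)
      also have "real (card ?G) = real v ^ 2 / real v ^ ?r"
        using card_lin_fibre[OF LA, of z v] zt by (simp add: V_def)
      also have "(\<Sum>t\<in>?T. q t) = (if A \<inter> B = {} then 1 else q (snd x))"
        using q(2) zt by simp
      finally show ?thesis using v by simp
    qed
    then have "fd.H ?Y = - (\<Sum>x\<in>\<Omega>. w x * log 2 ((if A \<inter> B = {} then 1 else q (snd x)) / real v ^ ?r))"
      unfolding fd.H_def by simp
    also have "\<dots> = - (\<Sum>t<n. q t * log 2 ((if A \<inter> B = {} then 1 else q t) / real v ^ ?r))"
      using marg by simp
    also have "\<dots> = - (\<Sum>t<n. (if A \<inter> B = {} then 0 else q t * log 2 (q t)) - q t * (?r * log 2 v))"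
      using q(1) v
      by (intro arg_cong[where f = uminus] sum.cong refl)
         (auto simp: log_divide log_nat_power right_diff_distrib less_imp_neq[symmetric])
    also have "\<dots> = (if A \<inter> B = {} then 0 else b) + ?r * log 2 v"
      using q(2,3) by (simp add: sum_subtractf sum_distrib_right[symmetric])
    also have "\<dots> = h A" using h[OF A] by simp
    finally show ?thesis using ent by simp
  qed
  then show ?thesis using prM sf by (intro entropicI[of M X]) auto
qed

section \<open>The seven faces\<close>

lemma subset_N4_cases:
  assumes "A \<subseteq> N4"
  shows "A \<in> {{},{1},{2},{3},{4},{1,2},{1,3},{1,4},{2,3},{2,4},{3,4},
    {1,2,3},{1,2,4},{1,3,4},{2,3,4},{1,2,3,4}}"
proof -
  have "A \<in> Pow N4" using assms by simp
  also have "Pow N4 = {{},{1},{2},{3},{4},{1,2},{1,3},{1,4},{2,3},{2,4},{3,4},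
    {1,2,3},{1,2,4},{1,3,4},{2,3,4},{1,2,3,4}}"
    by (simp add: Pow_insert insert_commute)
  finally show ?thesis .
qed

text \<open>Replacing the set equality by membership conditions lets the simplifier evaluate the
  rank on explicit sets.\<close>

lemma W2_rank_doubleton:
  "W2_rank {i,j} A = (if A = {} then 0
    else if card A = 1 \<or> i \<in> A \<and> j \<in> A \<and> (\<forall>x\<in>A. x = i \<or> x = j) then 1 else 2)"
proof -
  have "A = {i,j} \<longleftrightarrow> i \<in> A \<and> j \<in> A \<and> (\<forall>x\<in>A. x = i \<or> x = j)" by blast
  then show ?thesis by (simp only: W2_rank_def)
qed

theorem mainTheorem5:
  fixes F :: "(nat set \<Rightarrow> real) \<times> (nat set \<Rightarrow> real)" and a b :: real and h :: "nat set \<Rightarrow> real"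
  assumes "F \<in> {(U_rank 2 {1,2,3}, U_rank 1 {1}),
                (U_rank 2 {1,2,3}, U_rank 1 {4}),
                (U_rank 2 {1,2,3}, U_rank 1 {1,4}),
                (W2_rank {1,4}, U_rank 1 {1}),
                (W2_rank {3,4}, U_rank 1 {1}),
                (W2_rank {1,4}, U_rank 1 {1,4}),
                (W2_rank {2,4}, U_rank 1 {1,4})}"
    and "a \<ge> 0" and "b \<ge> 0"
    and "h = face_point F a b"
  shows "entropic h \<longleftrightarrow> (\<exists>v::nat. v \<ge> 1 \<and> a = log 2 (real v))"
proof
  assume ent: "entropic h"
  \<comment> \<open>Restricted to 123, every face is spanned by \<open>U\<^sub>2\<^sub>,\<^sub>3\<close> and the rank function of the element 1,
    except that for \<open>U\<^sub>1\<^sub>,\<^sub>1\<close> on 4 the second summand vanishes there.\<close>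
  have "h {1} = a + c \<and> h {2} = a \<and> h {3} = a \<and> h {1,2} = 2 * a + c \<and> h {1,3} = 2 * a + c
      \<and> h {2,3} = 2 * a \<and> h {1,2,3} = 2 * a + c"
    if "c = (if snd F {1} = 0 then 0 else b)" for c
    using assms(1) unfolding insert_iff empty_iff
    by (elim disjE FalseE; simp add: that assms(4) face_point_def U_rank_def W2_rank_doubleton)
  then show "\<exists>v::nat. v \<ge> 1 \<and> a = log 2 (real v)"
    using entropic_imp_log[OF ent] by blast
next
  assume "\<exists>v::nat. v \<ge> 1 \<and> a = log 2 (real v)"
  then obtain v :: nat where v: "v \<ge> 1" "a = log 2 (real v)" by blast
  \<comment> \<open>Elements 1, 2, 3 keep their own index and only the role of 4 varies:
    \<open>k = 0\<close> makes it a loop, as in \<open>U_{2,3}\<close> on 123, while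
    \<open>k\<close> in 1, 2, 3 makes it parallel to \<open>k\<close>, as in \<open>W_2\<close> on
    the pair of \<open>k\<close> and 4. \<open>B\<close> is the support of the second
    matroid.\<close>
  have lin: "entropic h"
    if k: "k \<le> 3" and hA: "\<forall>A\<in>{{},{1},{2},{3},{4},{1,2},{1,3},{1,4},{2,3},{2,4},{3,4},
        {1,2,3},{1,2,4},{1,3,4},{2,3,4},{1,2,3,4}}.
        h A = a * real (min 2 (card ((\<lambda>i. if i = 4 then k else i) ` A - {0})))
          + (if A \<inter> B = {} then 0 else b)"
    for k :: nat and B
  proof (rule entropic_lin[OF v(1) assms(3)])
    show "(if i = 4 then k else i) \<le> 3" if "i \<in> N4" for i
      using that k by auto
    show "h A = log 2 v * real (min 2 (card ((\<lambda>i. if i = 4 then k else i) ` A - {0})))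
        + (if A \<inter> B = {} then 0 else b)" if "A \<subseteq> N4" for A
      unfolding v(2)[symmetric] using hA subset_N4_cases[OF that] by (rule bspec)
  qed
  consider "F = (U_rank 2 {1,2,3}, U_rank 1 {1})" | "F = (U_rank 2 {1,2,3}, U_rank 1 {4})"
    | "F = (U_rank 2 {1,2,3}, U_rank 1 {1,4})" | "F = (W2_rank {1,4}, U_rank 1 {1})"
    | "F = (W2_rank {3,4}, U_rank 1 {1})" | "F = (W2_rank {1,4}, U_rank 1 {1,4})"
    | "F = (W2_rank {2,4}, U_rank 1 {1,4})"
    using assms(1) by blast
  then show "entropic h"
  proof cases
    case 1
    then show ?thesis
      by (intro lin[of 0 "{1}"])
         (simp_all add: assms(4) face_point_def U_rank_def W2_rank_doubleton insert_Diff_if card_insert_if)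
  next
    case 2
    then show ?thesis
      by (intro lin[of 0 "{4}"])
         (simp_all add: assms(4) face_point_def U_rank_def W2_rank_doubleton insert_Diff_if card_insert_if)
  next
    case 3
    then show ?thesis
      by (intro lin[of 0 "{1,4}"])
         (simp_all add: assms(4) face_point_def U_rank_def W2_rank_doubleton insert_Diff_if card_insert_if)
  next
    case 4
    then show ?thesis
      by (intro lin[of 1 "{1}"])
         (simp_all add: assms(4) face_point_def U_rank_def W2_rank_doubleton insert_Diff_if card_insert_if)
  next
    case 5
    then show ?thesis
      by (intro lin[of 3 "{1}"])
         (simp_all add: assms(4) face_point_def U_rank_def W2_rank_doubleton insert_Diff_if card_insert_if)
  next
    case 6
    then show ?thesis
      by (intro lin[of 1 "{1,4}"])
         (simp_all add: assms(4) face_point_def U_rank_def W2_rank_doubleton insert_Diff_if card_insert_if)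
  next
    case 7
    then show ?thesis
      by (intro lin[of 2 "{1,4}"])
         (simp_all add: assms(4) face_point_def U_rank_def W2_rank_doubleton insert_Diff_if card_insert_if)
  qed
qed

end
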